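(* Let $S_1,\dots,S_T$ ($T\ge2$) be finite binary classification datasets of pairs $(\mathbf x,y)\in\mathbb R^d\times\{-1,+1\}$ that are jointly separable, and let $R=\max\{\|\mathbf x\|:(\mathbf x,y)\in S_1\cup\dots\cup S_T\}$. Let $\mathcal C_m=\{\mathbf w\in\mathbb R^d: y\,\mathbf w^\top\mathbf x\ge1\ \forall(\mathbf x,y)\in S_m\}$. Let $\tau$ be a random ordering of the tasks, with or without replacement, and let $\mathbf w_0=\mathbf 0,\mathbf w_1,\dots,\mathbf w_k$ be the iterates representing the limit $\lambda\to0$ of weakly-regularized continual linear classification, i.e. $\mathbf w_t=\Pi_{\tau(t)}(\mathbf w_{t-1})$. Let $F_\tau(k)$ be the forgetting of these iterates. Then for every $k\ge1$ (with $k\le T$ when $\tau$ is without replacement), $$\mathbb E_\tau[F_\tau(k)]\le\frac{7\|\mathbf w_\star\|^2R^2}{\sqrt[4]{k}},\qquad\text{where }\ \mathbf w_\star\in\operatorname*{argmin}_{\mathbf w\in\mathcal C_1\cap\dots\cap\mathcal C_T}\|\mathbf w_0-\mathbf w\|^2 .$$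
   Context: $\|\cdot\|$ is the Euclidean norm and $\Pi_m(\mathbf w)=\operatorname{argmin}_{\mathbf v\in\mathcal C_m}\|\mathbf v-\mathbf w\|$. Joint separability means $\mathcal C_1\cap\dots\cap\mathcal C_T\neq\varnothing$. Random ordering: $\tau(1),\dots,\tau(k)$ are drawn uniformly from $\{1,\dots,T\}$, either i.i.d. (with replacement) or as the first $k$ entries of a uniformly random permutation (without replacement). Weakly-regularized continual linear classification: $\mathbf w_0^{(\lambda)}=\mathbf 0$ and $\mathbf w_t^{(\lambda)}=\operatorname{argmin}_{\mathbf w}\sum_{(\mathbf x,y)\in S_{\tau(t)}}e^{-y\mathbf w^\top\mathbf x}+\frac\lambda2\|\mathbf w-\mathbf w_{t-1}^{(\lambda)}\|^2$. It is known (and taken here as the definition of the limiting iterates) that as $\lambda\to0$ these iterates align in direction with the sequential projections $\mathbf w_t=\Pi_{\tau(t)}(\mathbf w_{t-1})$, $\mathbf w_0=\mathbf 0$; forgetting is measured on the latter. Forgetting: $F_\tau(k)=\frac1k\sum_{t=1}^k\big(\mathcal L_{\tau(t)}(\mathbf w_k)-\mathcal L_{\tau(t)}(\mathbf w_t)\big)$, where $\mathcal L_m:\mathbb R^d\to[0,\infty)$ is the loss of task $m$ (of squared-hinge type), which vanishes on $\mathcal C_m$ and satisfies $\mathcal L_m(\mathbf w)\le\frac{R^2}{2}\|\mathbf w-\Pi_m(\mathbf w)\|^2$ for all $\mathbf w$; consequently $F_\tau(k)\le\frac{R^2}{2k}\sum_{t=1}^k\|\mathbf w_k-\Pi_{\tau(t)}(\mathbf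 w_k)\|^2$. Only these properties of $\mathcal L_m$ are assumed. *)

theory Defs
  imports "HOL-Analysis.Analysis" "HOL-Probability.Probability"
    "HOL-Combinatorics.Permutations"
begin

type_synonym 'n dataset = "((real ^ 'n) \<times> real) set"

definition binary_dataset :: "('n::finite) dataset \<Rightarrow> bool" where
  "binary_dataset D \<longleftrightarrow> finite D \<and> (\<forall>(x, y)\<in>D. y = -1 \<or> y = 1)"

definition feasible :: "('n::finite) dataset \<Rightarrow> (real ^ 'n) set" where
  "feasible D = {w. \<forall>(x, y)\<in>D. y * (w \<bullet> x) \<ge> 1}"

text \<open>
  Tasks are indexed by 1, ..., T.  If all datasets are empty, the maximum below is an
  unspecified number.
\<close>
definition data_radius :: "(nat \<Rightarrow> ('n::finite) dataset) \<Rightarrow> nat \<Rightarrow> real" where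
  "data_radius S T = Max {norm x | x y. (x, y) \<in> (\<Union>m\<in>{1..T}. S m)}"

text \<open>
  The limit of the weakly-regularized iterates as the regularization strength tends to zero,
  taken by definition to be the sequential projections started at the origin.  The feasible
  sets are closed and convex, so on nonempty ones \<^const>\<open>closest_point\<close> is the unique minimizer
  of the distance.
\<close>
primrec iterate :: "(nat \<Rightarrow> ('n::finite) dataset) \<Rightarrow> (nat \<Rightarrow> nat) \<Rightarrow> nat \<Rightarrow> real ^ 'n" where
  "iterate S \<tau> 0 = 0"
| "iterate S \<tau> (Suc t) = closest_point (feasible (S (\<tau> (Suc t)))) (iterate S \<tau> t)"

definition task_loss :: "('n::finite) dataset \<Rightarrow> real \<Rightarrow> (real ^ 'n \<Rightarrow> real) \<Rightarrow> bool" where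
  "task_loss D R l \<longleftrightarrow>
     (\<forall>w. 0 \<le> l w) \<and>
     (\<forall>w\<in>feasible D. l w = 0) \<and>
     (\<forall>w. l w \<le> R\<^sup>2 / 2 * (norm (w - closest_point (feasible D) w))\<^sup>2)"

definition forgetting ::
  "(nat \<Rightarrow> ('n::finite) dataset) \<Rightarrow> (nat \<Rightarrow> real ^ 'n \<Rightarrow> real) \<Rightarrow> (nat \<Rightarrow> nat) \<Rightarrow> nat \<Rightarrow> real" where
  "forgetting S L \<tau> k =
     1 / real k * (\<Sum>t=1..k. L (\<tau> t) (iterate S \<tau> k) - L (\<tau> t) (iterate S \<tau> t))"

text \<open>
  Laws of the first \<^term>\<open>k\<close> entries of the ordering, as functions on the positions
  1, ..., k; outside these positions the functions take the value \<^const>\<open>undefined\<close>.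
\<close>
definition ordering_with_replacement :: "nat \<Rightarrow> nat \<Rightarrow> (nat \<Rightarrow> nat) pmf" where
  "ordering_with_replacement T k = Pi_pmf {1..k} undefined (\<lambda>_. pmf_of_set {1..T})"

definition ordering_without_replacement :: "nat \<Rightarrow> nat \<Rightarrow> (nat \<Rightarrow> nat) pmf" where
  "ordering_without_replacement T k =
     map_pmf (\<lambda>\<pi>. restrict \<pi> {1..k}) (pmf_of_set {\<pi>. \<pi> permutes {1..T}})"

end

theory Submission
  imports Defs
begin

text \<open>
  Write \<open>r\<^sub>m(w)\<close> for the squared distance of \<open>w\<close> to the feasible set of task \<open>m\<close>, and
  \<open>A\<^sub>s\<close> for the expectation of \<open>r\<^sub>m(w\<^sub>s)\<close> at an unseen task \<open>m = \<tau>(j)\<close>, \<open>s < j\<close>;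
  exchangeability of the ordering makes it independent of \<open>j\<close>, and exchangeability is the only
  property of the two sampling schemes that matters.  Comparing the iterates with \<open>w_star\<close> gives
  \<open>A\<^sub>0 + \<dots> + A\<^bsub>k-1\<^esub> \<le> norm(w_star)\<^sup>2\<close>.  Comparing them with an earlier iterate
  \<open>w\<^sub>s\<close>, which need not be feasible, gives that the mean of \<open>A\<^sub>s, \<dots>, A\<^bsub>k-1\<^esub>\<close> is at most
  \<open>4 A\<^sub>s\<close>.  Peeling off the terms one at a time costs a factor \<open>k\<^bsup>3/4\<^esup>\<close> between the mean
  of all the terms and the last one, so \<open>A\<^bsub>k-1\<^esub> \<le> 2 norm(w_star)\<^sup>2 / k\<^bsup>1/4\<^esup>\<close>.
  Finally, a seen task \<open>\<tau>(t)\<close> becomes an unseen one when step \<open>t\<close> is skipped.  As projections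
  are nonexpansive, skipping it moves \<open>w\<^sub>k\<close> by at most the length of that step, and the
  squared step lengths sum to at most \<open>norm(w_star)\<^sup>2\<close>.
\<close>

section \<open>Projections onto closed convex sets\<close>

definition sqdist :: "'a::euclidean_space set \<Rightarrow> 'a \<Rightarrow> real" where
  "sqdist C w = (norm (w - closest_point C w))\<^sup>2"

lemma norm_add_power2_le:
  fixes a b :: "'a::real_inner"
  shows "(norm (a + b))\<^sup>2 \<le> 2 * (norm a)\<^sup>2 + 2 * (norm b)\<^sup>2"
  using zero_le_power2[of "norm (a - b)"]
  by (simp add: power2_norm_eq_inner inner_add_left inner_add_right
      inner_diff_left inner_diff_right inner_commute)

lemma closest_point_fejer:
  fixes z w :: "'a::euclidean_space"
  assumes "convex C" "closed C" "z \<in> C"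
  shows "(norm (closest_point C w - z))\<^sup>2 \<le> (norm (w - z))\<^sup>2 - sqdist C w"
proof -
  define p where "p = closest_point C w"
  have "(w - p) \<bullet> (z - p) \<le> 0"
    unfolding p_def by (rule closest_point_dot[OF assms])
  then show ?thesis
    unfolding sqdist_def p_def[symmetric] power2_norm_eq_inner
    by (simp add: inner_diff_left inner_diff_right inner_commute)
qed

text \<open>As \<open>z\<close> may lie outside \<open>C\<close>, the variational inequality is
  applied at its projection \<open>q\<close>. Splitting \<open>w - p\<close> into its difference
  with \<open>z - q\<close> and \<open>z - q\<close> itself then halves the gain and puts the factor
  2 on \<open>sqdist C z\<close>.\<close>

lemma closest_point_approx_fejer:
  fixes z w :: "'a::euclidean_space"
  assumes "convex C" "closed C" "C \<noteq> {}"
  shows "(norm (closest_point C w - z))\<^sup>2 \<le> (norm (w - z))\<^sup>2 - sqdist C w / 2 + 2 * sqdist C z"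
proof -
  define p where "p = closest_point C w"
  define q where "q = closest_point C z"
  have "q \<in> C"
    unfolding q_def by (rule closest_point_in_set[OF assms(2,3)])
  then have "(w - p) \<bullet> (q - p) \<le> 0"
    unfolding p_def by (rule closest_point_dot[OF assms(1,2)])
  then have "(norm (p - z))\<^sup>2 \<le> (norm (w - z))\<^sup>2 + (norm (z - q))\<^sup>2 - (norm ((w - p) - (z - q)))\<^sup>2"
    unfolding power2_norm_eq_inner
    by (simp add: inner_diff_left inner_diff_right inner_commute)
  moreover have "(norm (w - p))\<^sup>2 \<le> 2 * (norm ((w - p) - (z - q)))\<^sup>2 + 2 * (norm (z - q))\<^sup>2"
    using norm_add_power2_le[of "(w - p) - (z - q)" "z - q"] by simp
  ultimately show ?thesis
    unfolding sqdist_def p_def[symmetric] q_def[symmetric] by simp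
qed

lemma sqdist_perturb:
  fixes v w :: "'a::euclidean_space"
  assumes "closed C" "C \<noteq> {}"
  shows "sqdist C w \<le> 2 * sqdist C v + 2 * (norm (w - v))\<^sup>2"
proof -
  have "closest_point C v \<in> C"
    by (rule closest_point_in_set[OF assms])
  then have "norm (w - closest_point C w) \<le> norm (w - closest_point C v)"
    using closest_point_le[OF assms(1), of "closest_point C v" w] by (simp add: dist_norm)
  then have "sqdist C w \<le> (norm ((w - v) + (v - closest_point C v)))\<^sup>2"
    unfolding sqdist_def by (simp add: power_mono)
  also have "\<dots> \<le> 2 * (norm (w - v))\<^sup>2 + 2 * (norm (v - closest_point C v))\<^sup>2"
    by (rule norm_add_power2_le)
  finally show ?thesis
    unfolding sqdist_def by simp
qed

section \<open>Feasible sets as intersections of half-spaces\<close>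

lemma feasible_alt: "feasible D = (\<Inter>(x, y)\<in>D. {w. (y *\<^sub>R x) \<bullet> w \<ge> 1})"
  by (auto simp: feasible_def inner_commute)

lemma closed_feasible: "closed (feasible D)"
  unfolding feasible_alt by (intro closed_INT ballI) (auto simp: closed_halfspace_ge simp del: inner_scaleR_left)

lemma convex_feasible: "convex (feasible D)"
  unfolding feasible_alt by (intro convex_INT) (auto simp: convex_halfspace_ge simp del: inner_scaleR_left)

lemma iterate_cong:
  assumes "\<And>i. i \<in> {1..s} \<Longrightarrow> \<tau> i = \<tau>' i"
  shows "iterate S \<tau> s = iterate S \<tau>' s"
  using assms by (induction s) auto

section \<open>The last term of a sequence with controlled tail means\<close>

text \<open>With x = 1/m this says that (1 + x)^(-1/4) lies above its tangent 1 - x/4 at 0, by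
  convexity.\<close>

lemma root_peel:
  assumes "m \<ge> (1::real)"
  shows "(1 - 1 / (4 * m)) / root 4 m \<le> 1 / root 4 (m + 1)"
proof (rule power_le_imp_le_base[where n = 3])
  \<comment> \<open>Fourth powers of both sides, with denominators cleared.\<close>
  have "(4 * m - 1) ^ 4 * (m + 1) \<le> 256 * m ^ 5"
  proof -
    have "160 * m ^ 3 \<ge> 80 * m ^ 2"
      using assms by (simp add: power2_eq_square power3_eq_cube mult_mono)
    moreover have "(4 * m - 1) ^ 4 * (m + 1) = 256 * m ^ 5 - 160 * m ^ 3 + 80 * m ^ 2 - 15 * m + 1"
      by algebra
    ultimately show ?thesis
      using assms by linarith
  qed
  then have "((1 - 1 / (4 * m)) / root 4 m) ^ 4 \<le> (1 / root 4 (m + 1)) ^ 4"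
    using assms
    by (simp add: power_divide divide_simps) (simp add: algebra_simps eval_nat_numeral)
  then show "((1 - 1 / (4 * m)) / root 4 m) ^ Suc 3 \<le> (1 / root 4 (m + 1)) ^ Suc 3"
    by simp
qed (use assms in simp)

text \<open>
  The sequence is indexed backwards: \<open>b 0\<close> is the last term.  The shift in \<open>n + 2\<close> is what
  lets the induction close.
\<close>

lemma last_term_le:
  fixes b :: "nat \<Rightarrow> real"
  assumes "\<And>j. j \<le> n \<Longrightarrow> 0 \<le> b j"
    and "\<And>j. j \<le> n \<Longrightarrow> (\<Sum>i\<le>j. b i) \<le> 4 * (real j + 1) * b j"
  shows "b 0 \<le> 2 / root 4 (real n + 2) * (\<Sum>i\<le>n. b i)"
  using assms
proof (induction n)
  case 0
  have "root 4 2 \<le> root 1 (2::real)"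
    by (rule real_root_decreasing) auto
  then have "1 \<le> 2 / root 4 (2::real)"
    by simp
  then show ?case
    using 0(1)[of 0] mult_right_mono[of 1 "2 / root 4 2" "b 0"] by simp
next
  case (Suc n)
  define B where "B = (\<Sum>i\<le>n. b i)"
  have "B + b (Suc n) \<le> 4 * (real n + 2) * b (Suc n)"
    using Suc.prems(2)[of "Suc n"] by (simp add: B_def algebra_simps)
  \<comment> \<open>The newly added earliest term is at least the fraction
    \<open>1 / (4 * (real n + 2))\<close> of the whole sum, so dropping it loses at least that
    fraction.\<close>
  then have B: "B \<le> (1 - 1 / (4 * (real n + 2))) * (B + b (Suc n))"
    by (simp add: field_simps)
  have nonneg: "0 \<le> B + b (Suc n)"
    using Suc.prems(1) by (auto simp: B_def intro!: add_nonneg_nonneg sum_nonneg)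
  have "b 0 \<le> 2 / root 4 (real n + 2) * B"
    unfolding B_def using Suc by simp
  also have "\<dots> \<le> 2 / root 4 (real n + 2) * ((1 - 1 / (4 * (real n + 2))) * (B + b (Suc n)))"
    by (intro mult_left_mono B) simp
  also have "\<dots> = 2 * ((1 - 1 / (4 * (real n + 2))) / root 4 (real n + 2)) * (B + b (Suc n))"
    by simp
  also have "\<dots> \<le> 2 * (1 / root 4 (real n + 2 + 1)) * (B + b (Suc n))"
    by (intro mult_right_mono mult_left_mono root_peel nonneg) simp_all
  finally show ?case
    by (simp add: B_def add.commute)
qed

section \<open>Exchangeable orderings\<close>

text \<open>Moves position \<open>t\<close> to the end, so that the first \<open>k - 1\<close> steps skip it.\<close>

definition postpone :: "nat \<Rightarrow> nat \<Rightarrow> nat \<Rightarrow> nat" where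
  "postpone t k i = (if i < t \<or> k < i then i else if i = k then t else Suc i)"

lemma postpone_permutes:
  assumes "t \<in> {1..k}"
  shows "postpone t k permutes {1..k}"
proof (rule bij_imp_permutes)
  show "bij_betw (postpone t k) {1..k} {1..k}"
    by (rule bij_betw_byWitness[where f' = "\<lambda>i. if i < t then i else if i = t then k else i - 1"])
       (use assms in \<open>auto simp: postpone_def\<close>)
qed (use assms in \<open>auto simp: postpone_def\<close>)

text \<open>Feasibility of \<open>w_star\<close> is demanded only on the support and at positions 1
  to \<open>k\<close>, since both orderings are \<open>undefined\<close> elsewhere. Finite support
  settles all integrability.\<close>

locale exchangeable_ordering =
  fixes S :: "nat \<Rightarrow> ('n::finite) dataset"
    and p :: "(nat \<Rightarrow> nat) pmf"
    and k :: nat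
    and w_star :: "real ^ 'n"
  assumes finite_support: "finite (set_pmf p)"
    and exchangeable: "\<And>\<sigma>. \<sigma> permutes {1..k} \<Longrightarrow> map_pmf (\<lambda>\<tau>. \<tau> \<circ> \<sigma>) p = p"
    and star_feasible: "\<And>\<tau> t. \<tau> \<in> set_pmf p \<Longrightarrow> t \<in> {1..k} \<Longrightarrow> w_star \<in> feasible (S (\<tau> t))"
    and k_pos: "k \<ge> 1"
begin

abbreviation E :: "((nat \<Rightarrow> nat) \<Rightarrow> real) \<Rightarrow> real" where
  "E \<equiv> measure_pmf.expectation p"

abbreviation res :: "(nat \<Rightarrow> nat) \<Rightarrow> nat \<Rightarrow> real ^ 'n \<Rightarrow> real" where
  "res \<tau> t \<equiv> sqdist (feasible (S (\<tau> t)))"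

text \<open>This is A_s with the next position \<open>Suc s\<close> as representative, hence also
  the mean squared length of step \<open>Suc s\<close>.\<close>

definition unseen :: "nat \<Rightarrow> real" where
  "unseen s = E (\<lambda>\<tau>. res \<tau> (Suc s) (iterate S \<tau> s))"

lemma integrable_p: "integrable p (f :: _ \<Rightarrow> real)"
  by (rule integrable_measure_pmf_finite[OF finite_support])

lemma E_mono:
  assumes "\<And>\<tau>. \<tau> \<in> set_pmf p \<Longrightarrow> f \<tau> \<le> g \<tau>"
  shows "E f \<le> E g"
  using assms by (intro integral_mono_AE integrable_p AE_pmfI)

lemma E_permute:
  assumes "\<sigma> permutes {1..k}"
  shows "E (\<lambda>\<tau>. f (\<tau> \<circ> \<sigma>)) = E f"
proof -
  have "E f = measure_pmf.expectation (map_pmf (\<lambda>\<tau>. \<tau> \<circ> \<sigma>) p) f"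
    by (simp add: exchangeable[OF assms])
  then show ?thesis
    by simp
qed

lemma feasible_nonempty:
  "\<tau> \<in> set_pmf p \<Longrightarrow> t \<in> {1..k} \<Longrightarrow> feasible (S (\<tau> t)) \<noteq> {}"
  using star_feasible by blast

section \<open>Residuals at unseen tasks\<close>

lemma unseen_nonneg: "0 \<le> unseen s"
  unfolding unseen_def by (intro Bochner_Integration.integral_nonneg) (simp add: sqdist_def)

text \<open>Swapping positions \<open>Suc s\<close> and \<open>j\<close> preserves the law and
  leaves \<open>iterate S \<tau> s\<close> alone, which reads only the first \<open>s\<close>
  positions.\<close>

lemma E_res_unseen:
  assumes "s < j" "j \<le> k"
  shows "E (\<lambda>\<tau>. res \<tau> j (iterate S \<tau> s)) = unseen s"
proof -
  define \<sigma> where "\<sigma> = Transposition.transpose (Suc s) j"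
  have "\<sigma> permutes {1..k}"
    unfolding \<sigma>_def using assms by (intro permutes_swap_id) auto
  moreover have "iterate S (\<tau> \<circ> \<sigma>) s = iterate S \<tau> s" for \<tau>
    using assms by (intro iterate_cong) (auto simp: \<sigma>_def transpose_def)
  moreover have "\<sigma> j = Suc s"
    by (simp add: \<sigma>_def)
  ultimately show ?thesis
    using E_permute[of \<sigma> "\<lambda>\<tau>. res \<tau> j (iterate S \<tau> s)"] by (simp add: unseen_def)
qed

text \<open>The projection inequality at \<open>w_star\<close> telescopes along each ordering; the
  start at the origin gives the right-hand side.\<close>

lemma sum_res_le:
  assumes "\<tau> \<in> set_pmf p" "n \<le> k"
  shows "(norm (iterate S \<tau> n - w_star))\<^sup>2 + (\<Sum>s<n. res \<tau> (Suc s) (iterate S \<tau> s))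
    \<le> (norm w_star)\<^sup>2"
  using assms(2)
proof (induction n)
  case (Suc n)
  have "(norm (iterate S \<tau> (Suc n) - w_star))\<^sup>2
      \<le> (norm (iterate S \<tau> n - w_star))\<^sup>2 - res \<tau> (Suc n) (iterate S \<tau> n)"
    using Suc.prems
    by (auto intro!: closest_point_fejer convex_feasible closed_feasible star_feasible[OF assms(1)])
  then show ?case
    using Suc by simp
qed simp

lemma sum_res_le':
  assumes "\<tau> \<in> set_pmf p"
  shows "(\<Sum>s<k. res \<tau> (Suc s) (iterate S \<tau> s)) \<le> (norm w_star)\<^sup>2"
  using sum_res_le[OF assms order_refl] by (smt (verit) zero_le_power2)

lemma sum_unseen_le: "(\<Sum>s<k. unseen s) \<le> (norm w_star)\<^sup>2"
proof -
  have "(\<Sum>s<k. unseen s) = E (\<lambda>\<tau>. \<Sum>s<k. res \<tau> (Suc s) (iterate S \<tau> s))"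
    unfolding unseen_def by (simp add: integrable_p)
  also have "\<dots> \<le> E (\<lambda>_. (norm w_star)\<^sup>2)"
    by (intro E_mono sum_res_le')
  finally show ?thesis
    by simp
qed

text \<open>The squared distance to \<open>iterate S \<tau> s\<close> starts at 0 and stays
  nonnegative. A step decreases its mean by \<open>unseen n / 2\<close>, up to an error of mean
  \<open>2 * unseen s\<close>, because the task of step \<open>Suc n\<close> is unseen at time
  \<open>s\<close> too. The ratio of 2 to 1/2 is the factor 4.\<close>

lemma sum_unseen_tail_le:
  assumes "s \<le> n" "n \<le> k"
  shows "(\<Sum>t=s..<n. unseen t) \<le> 4 * (real n - real s) * unseen s"
proof -
  have "E (\<lambda>\<tau>. (norm (iterate S \<tau> n - iterate S \<tau> s))\<^sup>2)
      \<le> 2 * (real n - real s) * unseen s - (\<Sum>t=s..<n. unseen t) / 2"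
    using assms
  proof (induction n rule: dec_induct)
    case (step n)
    let ?dist = "\<lambda>n \<tau>. (norm (iterate S \<tau> n - iterate S \<tau> s))\<^sup>2"
    have "E (?dist (Suc n)) \<le> E (\<lambda>\<tau>. ?dist n \<tau> - res \<tau> (Suc n) (iterate S \<tau> n) / 2
        + 2 * res \<tau> (Suc n) (iterate S \<tau> s))"
      using step.prems
      by (intro E_mono) (simp add: closest_point_approx_fejer[OF convex_feasible closed_feasible]
          feasible_nonempty)
    also have "\<dots> = E (?dist n) - unseen n / 2 + 2 * E (\<lambda>\<tau>. res \<tau> (Suc n) (iterate S \<tau> s))"
      by (simp add: integrable_p unseen_def)
    also have "E (\<lambda>\<tau>. res \<tau> (Suc n) (iterate S \<tau> s)) = unseen s"
      using step by (intro E_res_unseen) auto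
    finally show ?case
      using step by (simp add: algebra_simps add_divide_distrib)
  qed simp
  moreover have "0 \<le> E (\<lambda>\<tau>. (norm (iterate S \<tau> n - iterate S \<tau> s))\<^sup>2)"
    by (intro Bochner_Integration.integral_nonneg) simp
  ultimately have "(\<Sum>t=s..<n. unseen t) / 2 \<le> 2 * (real n - real s) * unseen s"
    by linarith
  then show ?thesis
    by linarith
qed

lemma unseen_last_le: "unseen (k - 1) \<le> 2 * (norm w_star)\<^sup>2 / root 4 (real k)"
proof -
  define b where "b i = unseen (k - 1 - i)" for i
  have sum_b: "(\<Sum>i\<le>j. b i) = (\<Sum>t=k - 1 - j..<k. unseen t)" if "j \<le> k - 1" for j
    unfolding b_def
    by (rule sum.reindex_bij_witness[of _ "\<lambda>t. k - 1 - t" "\<lambda>i. k - 1 - i"]) (use that k_pos in auto)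
  have "b 0 \<le> 2 / root 4 (real (k - 1) + 2) * (\<Sum>i\<le>k - 1. b i)"
  proof (rule last_term_le)
    fix j
    assume j: "j \<le> k - 1"
    have "(\<Sum>t=k - 1 - j..<k. unseen t)
        \<le> 4 * (real k - real (k - 1 - j)) * unseen (k - 1 - j)"
      by (rule sum_unseen_tail_le) auto
    moreover have "real k - real (k - 1 - j) = real j + 1"
      using j k_pos by (simp add: of_nat_diff)
    ultimately show "(\<Sum>i\<le>j. b i) \<le> 4 * (real j + 1) * b j"
      unfolding sum_b[OF j] unfolding b_def by metis
  qed (simp add: b_def unseen_nonneg)
  also have "\<dots> \<le> 2 / root 4 (real k) * (norm w_star)\<^sup>2"
  proof (rule mult_mono)
    show "(\<Sum>i\<le>k - 1. b i) \<le> (norm w_star)\<^sup>2"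
      using sum_unseen_le by (simp add: sum_b atLeast0LessThan)
    \<comment> \<open>The left root is that of \<open>k + 1\<close>.\<close>
    show "2 / root 4 (real (k - 1) + 2) \<le> 2 / root 4 (real k)"
      using k_pos by (intro divide_left_mono) (auto simp: of_nat_diff)
  qed (auto simp: b_def unseen_nonneg intro: sum_nonneg)
  finally show ?thesis
    by (simp add: b_def)
qed

section \<open>Residuals at seen tasks\<close>

text \<open>The postponed trajectory runs one index behind. Just after step \<open>t\<close> the two
  differ by exactly that step; from then on both apply the same projections, which cannot widen the
  gap.\<close>

lemma norm_iterate_postpone_le:
  assumes "\<tau> \<in> set_pmf p" "t \<in> {1..k}"
  shows "(norm (iterate S \<tau> k - iterate S (\<tau> \<circ> postpone t k) (k - 1)))\<^sup>2
    \<le> res \<tau> t (iterate S \<tau> (t - 1))"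
proof -
  define \<tau>' where "\<tau>' = \<tau> \<circ> postpone t k"
  let ?v = "iterate S \<tau>'"
  have step: "iterate S \<tau> t = closest_point (feasible (S (\<tau> t))) (iterate S \<tau> (t - 1))"
    using assms(2) by (cases t) auto
  have "dist (iterate S \<tau> n) (?v (n - 1)) \<le> dist (iterate S \<tau> t) (iterate S \<tau> (t - 1))"
    if "t \<le> n" "n \<le> k" for n
    using that
  proof (induction n rule: dec_induct)
    case base
    have "?v (t - 1) = iterate S \<tau> (t - 1)"
      using assms(2) by (intro iterate_cong) (auto simp: \<tau>'_def postpone_def)
    then show ?case
      by (simp only: order_refl)
  next
    case (step n)
    have "n = Suc (n - 1)"
      using step.hyps assms(2) by auto
    then have "?v n = closest_point (feasible (S (\<tau>' n))) (?v (n - 1))"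
      by (metis iterate.simps(2))
    also have "\<tau>' n = \<tau> (Suc n)"
      using step by (simp add: \<tau>'_def postpone_def)
    finally have "dist (iterate S \<tau> (Suc n)) (?v n) \<le> dist (iterate S \<tau> n) (?v (n - 1))"
      using closest_point_lipschitz[OF convex_feasible closed_feasible
          feasible_nonempty[OF assms(1), of "Suc n"]] step.prems by simp
    then show ?case
      using step by simp
  qed
  from this[of k] have "dist (iterate S \<tau> k) (?v (k - 1))
      \<le> dist (iterate S \<tau> t) (iterate S \<tau> (t - 1))"
    using assms(2) by simp
  then show ?thesis
    unfolding sqdist_def step \<tau>'_def[symmetric] by (intro power_mono) (simp_all add: dist_norm norm_minus_commute)
qed

lemma E_res_seen_le:
  assumes "t \<in> {1..k}"
  shows "E (\<lambda>\<tau>. res \<tau> t (iterate S \<tau> k))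
    \<le> 2 * unseen (k - 1) + 2 * E (\<lambda>\<tau>. res \<tau> t (iterate S \<tau> (t - 1)))"
proof -
  let ?\<sigma> = "postpone t k"
  have "E (\<lambda>\<tau>. res \<tau> t (iterate S \<tau> k))
      \<le> E (\<lambda>\<tau>. 2 * res \<tau> t (iterate S (\<tau> \<circ> ?\<sigma>) (k - 1)) + 2 * res \<tau> t (iterate S \<tau> (t - 1)))"
  proof (rule E_mono)
    fix \<tau>
    assume \<tau>: "\<tau> \<in> set_pmf p"
    show "res \<tau> t (iterate S \<tau> k)
        \<le> 2 * res \<tau> t (iterate S (\<tau> \<circ> ?\<sigma>) (k - 1)) + 2 * res \<tau> t (iterate S \<tau> (t - 1))"
      using norm_iterate_postpone_le[OF \<tau> assms]
        sqdist_perturb[OF closed_feasible feasible_nonempty[OF \<tau> assms],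
          of "iterate S \<tau> k" "iterate S (\<tau> \<circ> ?\<sigma>) (k - 1)"]
      by linarith
  qed
  also have "\<dots> = 2 * E (\<lambda>\<tau>. res \<tau> t (iterate S (\<tau> \<circ> ?\<sigma>) (k - 1)))
      + 2 * E (\<lambda>\<tau>. res \<tau> t (iterate S \<tau> (t - 1)))"
    by (simp add: integrable_p)
  \<comment> \<open>Since \<open>postpone t k\<close> sends \<open>k\<close> to \<open>t\<close>,
    the task \<open>\<tau> t\<close> is the last entry of the permuted ordering, unseen by its first
    \<open>k - 1\<close> steps.\<close>
  also have "E (\<lambda>\<tau>. res \<tau> t (iterate S (\<tau> \<circ> ?\<sigma>) (k - 1))) = E (\<lambda>\<tau>. res \<tau> k (iterate S \<tau> (k - 1)))"
    using E_permute[OF postpone_permutes[OF assms], of "\<lambda>\<tau>. res \<tau> k (iterate S \<tau> (k - 1))"] assms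
    by (simp add: postpone_def)
  also have "\<dots> = unseen (k - 1)"
    using k_pos by (intro E_res_unseen) auto
  finally show ?thesis .
qed

lemma E_forgetting_le:
  assumes "\<And>\<tau> t. \<tau> \<in> set_pmf p \<Longrightarrow> t \<in> {1..k} \<Longrightarrow> task_loss (S (\<tau> t)) R (L (\<tau> t))"
  shows "E (\<lambda>\<tau>. forgetting S L \<tau> k) \<le> 3 * (norm w_star)\<^sup>2 * R\<^sup>2 / root 4 (real k)"
proof -
  let ?D = "(norm w_star)\<^sup>2"
  have "E (\<lambda>\<tau>. forgetting S L \<tau> k)
      \<le> E (\<lambda>\<tau>. R\<^sup>2 / (2 * real k) * (\<Sum>t=1..k. res \<tau> t (iterate S \<tau> k)))"
  proof (rule E_mono)
    fix \<tau>
    assume \<tau>: "\<tau> \<in> set_pmf p"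
    \<comment> \<open>The subtracted loss is nonnegative and is dropped.\<close>
    have "L (\<tau> t) (iterate S \<tau> k) - L (\<tau> t) (iterate S \<tau> t) \<le> R\<^sup>2 / 2 * res \<tau> t (iterate S \<tau> k)"
      if t: "t \<in> {1..k}" for t
      using assms[OF \<tau> t] unfolding task_loss_def sqdist_def by (smt (verit))
    then have "(\<Sum>t=1..k. L (\<tau> t) (iterate S \<tau> k) - L (\<tau> t) (iterate S \<tau> t))
        \<le> (\<Sum>t=1..k. R\<^sup>2 / 2 * res \<tau> t (iterate S \<tau> k))"
      by (rule sum_mono)
    then show "forgetting S L \<tau> k \<le> R\<^sup>2 / (2 * real k) * (\<Sum>t=1..k. res \<tau> t (iterate S \<tau> k))"
      unfolding forgetting_def sum_distrib_left[symmetric] using k_pos by (simp add: field_simps)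
  qed
  also have "\<dots> = R\<^sup>2 / (2 * real k) * (\<Sum>t=1..k. E (\<lambda>\<tau>. res \<tau> t (iterate S \<tau> k)))"
    by (simp add: integrable_p)
  also have "\<dots> \<le> R\<^sup>2 / (2 * real k) *
      (\<Sum>t=1..k. 2 * unseen (k - 1) + 2 * E (\<lambda>\<tau>. res \<tau> t (iterate S \<tau> (t - 1))))"
    by (intro mult_left_mono sum_mono E_res_seen_le) auto
  also have "(\<Sum>t=1..k. 2 * unseen (k - 1) + 2 * E (\<lambda>\<tau>. res \<tau> t (iterate S \<tau> (t - 1))))
      = 2 * real k * unseen (k - 1) + 2 * (\<Sum>s<k. unseen s)"
  proof -
    have "(\<Sum>t=1..k. E (\<lambda>\<tau>. res \<tau> t (iterate S \<tau> (t - 1)))) = (\<Sum>s<k. unseen s)"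
      by (simp add: unseen_def sum.atLeast1_atMost_eq)
    then show ?thesis
      by (simp add: sum.distrib sum_distrib_left[symmetric])
  qed
  also have "R\<^sup>2 / (2 * real k) * \<dots> \<le> R\<^sup>2 / (2 * real k) * (2 * real k * (2 * ?D / root 4 (real k)) + 2 * ?D)"
    by (intro mult_left_mono add_mono unseen_last_le sum_unseen_le) auto
  also have "\<dots> = R\<^sup>2 * ?D * (2 / root 4 (real k) + 1 / real k)"
    using k_pos by (simp add: field_simps)
  \<comment> \<open>The constant 3 is 2 from the last unseen residual plus 1 from the summed squared
    steps, as 1/k is at most k^(-1/4).\<close>
  also have "\<dots> \<le> R\<^sup>2 * ?D * (2 / root 4 (real k) + 1 / root 4 (real k))"
  proof -
    have "root 4 (real k) \<le> root 1 (real k)"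
      using k_pos by (intro real_root_decreasing) auto
    then show ?thesis
      using k_pos by (intro mult_left_mono add_mono divide_left_mono) auto
  qed
  finally show ?thesis
    by (simp add: field_simps)
qed

end

section \<open>The two sampling schemes\<close>

lemma ordering_with_replacement_range:
  assumes "\<tau> \<in> set_pmf (ordering_with_replacement T k)" "t \<in> {1..k}" "T \<ge> 1"
  shows "\<tau> t \<in> {1..T}"
  using assms by (auto simp: ordering_with_replacement_def set_Pi_pmf PiE_dflt_def set_pmf_of_set)

lemma set_pmf_ordering_without_replacement:
  "set_pmf (ordering_without_replacement T k)
    = (\<lambda>\<pi>. restrict \<pi> {1..k}) ` {\<pi>. \<pi> permutes {1..T}}"
proof -
  have "{\<pi>. \<pi> permutes {1..T}} \<noteq> {}"
    using permutes_id[of "{1..T}"] by blast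
  from set_pmf_of_set[OF this] show ?thesis
    by (simp add: ordering_without_replacement_def finite_permutations)
qed

lemma ordering_without_replacement_range:
  assumes "\<tau> \<in> set_pmf (ordering_without_replacement T k)" "t \<in> {1..k}" "k \<le> T"
  shows "\<tau> t \<in> {1..T}"
proof -
  obtain \<pi> where "\<pi> permutes {1..T}" "\<tau> = restrict \<pi> {1..k}"
    using assms(1) unfolding set_pmf_ordering_without_replacement by blast
  then show ?thesis
    using assms(2,3) permutes_in_image[of \<pi> "{1..T}" t] by auto
qed

lemma exchangeable_ordering_with_replacement:
  assumes "T \<ge> 1" "k \<ge> 1" "\<And>m. m \<in> {1..T} \<Longrightarrow> w_star \<in> feasible (S m)"
  shows "exchangeable_ordering S (ordering_with_replacement T k) k w_star"
proof
  show "finite (set_pmf (ordering_with_replacement T k))"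
    using assms(1)
    by (auto simp: ordering_with_replacement_def set_Pi_pmf set_pmf_of_set intro!: finite_PiE_dflt)
  show "w_star \<in> feasible (S (\<tau> t))"
    if "\<tau> \<in> set_pmf (ordering_with_replacement T k)" "t \<in> {1..k}" for \<tau> t
    using ordering_with_replacement_range[OF that assms(1)] by (rule assms(3))
  \<comment> \<open>Reindexing i.i.d. coordinates keeps their law; \<open>\<sigma>\<close> maps no
    outside position into \<open>{1..k}\<close>, so the default value stays in place.\<close>
  show "map_pmf (\<lambda>\<tau>. \<tau> \<circ> \<sigma>) (ordering_with_replacement T k) = ordering_with_replacement T k"
    if "\<sigma> permutes {1..k}" for \<sigma>
    unfolding ordering_with_replacement_def
    by (rule Pi_pmf_bij_betw[symmetric])
      (use that permutes_in_image[OF that] in \<open>auto simp: permutes_imp_bij\<close>)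
qed (rule assms(2))

lemma exchangeable_ordering_without_replacement:
  assumes "k \<ge> 1" "k \<le> T" "\<And>m. m \<in> {1..T} \<Longrightarrow> w_star \<in> feasible (S m)"
  shows "exchangeable_ordering S (ordering_without_replacement T k) k w_star"
proof
  show "finite (set_pmf (ordering_without_replacement T k))"
    by (simp add: set_pmf_ordering_without_replacement finite_permutations)
  show "w_star \<in> feasible (S (\<tau> t))"
    if "\<tau> \<in> set_pmf (ordering_without_replacement T k)" "t \<in> {1..k}" for \<tau> t
    using ordering_without_replacement_range[OF that assms(2)] by (rule assms(3))
  show "map_pmf (\<lambda>\<tau>. \<tau> \<circ> \<sigma>) (ordering_without_replacement T k) = ordering_without_replacement T k"
    if \<sigma>: "\<sigma> permutes {1..k}" for \<sigma>
  proof -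
    have fin: "finite {\<pi>. \<pi> permutes {1..T}}"
      by (simp add: finite_permutations)
    have ne: "{\<pi>. \<pi> permutes {1..T}} \<noteq> {}"
      using permutes_id[of "{1..T}"] by blast
    \<comment> \<open>As \<open>k \<le> T\<close>, composing with \<open>\<sigma>\<close> permutes
      the permutations of \<open>{1..T}\<close>, which preserves the uniform law. It commutes with
      the restriction because \<open>\<sigma>\<close> preserves \<open>{1..k}\<close>.\<close>
    have \<sigma>T: "\<sigma> permutes {1..T}"
      using assms(2) by (intro permutes_subset[OF \<sigma>]) auto
    have bij: "bij_betw (\<lambda>\<pi>. \<pi> \<circ> \<sigma>) {\<pi>. \<pi> permutes {1..T}} {\<pi>. \<pi> permutes {1..T}}"
      by (rule bij_betw_byWitness[where f' = "\<lambda>\<pi>. \<pi> \<circ> inv \<sigma>"])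
        (use \<sigma>T permutes_inv[OF \<sigma>T] in
          \<open>auto simp: o_assoc[symmetric] permutes_inv_o[OF \<sigma>T] intro: permutes_compose\<close>)
    have restrict_comp: "restrict \<pi> {1..k} \<circ> \<sigma> = restrict (\<pi> \<circ> \<sigma>) {1..k}" for \<pi> :: "nat \<Rightarrow> nat"
      using permutes_in_image[OF \<sigma>] by (auto simp: fun_eq_iff restrict_def)
    have "map_pmf (\<lambda>\<tau>. \<tau> \<circ> \<sigma>) (ordering_without_replacement T k)
        = map_pmf (\<lambda>\<pi>. restrict \<pi> {1..k})
            (map_pmf (\<lambda>\<pi>. \<pi> \<circ> \<sigma>) (pmf_of_set {\<pi>. \<pi> permutes {1..T}}))"
      unfolding ordering_without_replacement_def pmf.map_comp
      by (rule map_pmf_cong) (simp_all only: restrict_comp o_apply[where f = "\<lambda>\<tau>. \<tau> \<circ> \<sigma>"]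
          o_apply[where f = "\<lambda>\<pi>. restrict \<pi> {1..k}"])
    then show ?thesis
      unfolding map_pmf_of_set_bij_betw[OF bij ne fin]
      by (simp only: ordering_without_replacement_def)
  qed
qed (rule assms(1))

theorem theorem16:
  fixes S :: "nat \<Rightarrow> ('n::finite) dataset"
    and L :: "nat \<Rightarrow> real ^ 'n \<Rightarrow> real"
    and w_star :: "real ^ 'n"
    and T k :: nat
    and R :: real
  assumes "T \<ge> 2"
    and "\<And>m. m \<in> {1..T} \<Longrightarrow> binary_dataset (S m)"
    and "(\<Inter>m\<in>{1..T}. feasible (S m)) \<noteq> {}"
    and "R = data_radius S T"
    and "\<And>m. m \<in> {1..T} \<Longrightarrow> task_loss (S m) R (L m)"
    and "is_arg_min (\<lambda>w. (norm (0 - w))\<^sup>2) (\<lambda>w. w \<in> (\<Inter>m\<in>{1..T}. feasible (S m))) w_star"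
    and "k \<ge> 1"
  shows "measure_pmf.expectation (ordering_with_replacement T k) (\<lambda>\<tau>. forgetting S L \<tau> k)
           \<le> 7 * (norm w_star)\<^sup>2 * R\<^sup>2 / root 4 (real k)
       \<and> (k \<le> T \<longrightarrow>
           measure_pmf.expectation (ordering_without_replacement T k) (\<lambda>\<tau>. forgetting S L \<tau> k)
             \<le> 7 * (norm w_star)\<^sup>2 * R\<^sup>2 / root 4 (real k))"
proof (intro conjI impI)
  have star: "w_star \<in> feasible (S m)" if "m \<in> {1..T}" for m
    using assms(6) that by (auto simp: is_arg_min_def)
  have weaken: "3 * (norm w_star)\<^sup>2 * R\<^sup>2 / root 4 (real k)
      \<le> 7 * (norm w_star)\<^sup>2 * R\<^sup>2 / root 4 (real k)"
    by (intro divide_right_mono mult_right_mono) auto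
  interpret with_repl: exchangeable_ordering S "ordering_with_replacement T k" k w_star
    using assms(1,7) star by (intro exchangeable_ordering_with_replacement) auto
  show "measure_pmf.expectation (ordering_with_replacement T k) (\<lambda>\<tau>. forgetting S L \<tau> k)
      \<le> 7 * (norm w_star)\<^sup>2 * R\<^sup>2 / root 4 (real k)"
    using assms(1,5) ordering_with_replacement_range[of _ T k]
    by (intro order_trans[OF with_repl.E_forgetting_le[where R = R] weaken]) auto
  assume "k \<le> T"
  then interpret without_repl: exchangeable_ordering S "ordering_without_replacement T k" k w_star
    using assms(7) star by (intro exchangeable_ordering_without_replacement) auto
  show "measure_pmf.expectation (ordering_without_replacement T k) (\<lambda>\<tau>. forgetting S L \<tau> k)
      \<le> 7 * (norm w_star)\<^sup>2 * R\<^sup>2 / root 4 (real k)"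
    using \<open>k \<le> T\<close> assms(5) ordering_without_replacement_range[of _ T k]
    by (intro order_trans[OF without_repl.E_forgetting_le[where R = R] weaken]) auto
qed

end
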